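(* Let $T=\{3412,3421,2341\}$ and let $F_T(x)=\sum_{n\ge0}|S_n(T)|x^n$. Then $$F_T(x)=1+\frac{1+rt}{1+1/r+1/t-1/x},$$ where $$r=r(x)=\frac{\left(\sqrt{5}-1\right)\left(1-\sqrt{1-\left(3+\sqrt{5}\right)x+\frac{1}{2}\left(3-\sqrt{5}\right)x^2}\right)-\left(1+\sqrt{5}\right)x}{4x}$$ and $t=t(x)$ is the same expression as $r$ but with $\sqrt{5}$ replaced by $-\sqrt{5}$ throughout (the inner square roots being the power series with constant term $1$).
   Context: $S_n$ is the set of permutations of $[n]$ ($S_0$ contains the empty permutation). A permutation avoids a pattern $\tau$ if it has no subsequence order-isomorphic to $\tau$; $S_n(T)$ is the set of permutations in $S_n$ avoiding every pattern in $T$. *)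

theory Defs
  imports
    "HOL-Library.Sublist"
    "HOL-Combinatorics.Multiset_Permutations"
    "HOL-Computational_Algebra.Formal_Laurent_Series"
    Complex_Main
begin

text \<open>
  Permutations of \<open>[n]\<close> are written in one-line notation, i.e. as the lists in
  \<^term>\<open>permutations_of_set {1..n}\<close>; patterns are lists as well.
\<close>

definition order_isomorphic :: "nat list \<Rightarrow> nat list \<Rightarrow> bool" where
  "order_isomorphic u v \<longleftrightarrow>
     length u = length v \<and>
     (\<forall>i < length u. \<forall>j < length u. u ! i < u ! j \<longleftrightarrow> v ! i < v ! j)"

definition avoids :: "nat list \<Rightarrow> nat list \<Rightarrow> bool" where
  "avoids w p \<longleftrightarrow> \<not> (\<exists>u. subseq u w \<and> order_isomorphic u p)"

definition avoiding_perms :: "nat \<Rightarrow> nat list set \<Rightarrow> nat list set" where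
  "avoiding_perms n T = {w \<in> permutations_of_set {1..n}. \<forall>p \<in> T. avoids w p}"

definition avoidance_gf :: "nat list set \<Rightarrow> real fps" where
  "avoidance_gf T = Abs_fps (\<lambda>n. of_nat (card (avoiding_perms n T)))"

text \<open>
  The expression defining \<open>r(x)\<close>, with the number \<open>s\<close> in place of \<open>\<surd>5\<close>. The radicand has
  constant term \<open>1\<close>, and \<^term>\<open>fps_radical root 2\<close> selects its square root with constant
  term \<^term>\<open>root 2 1 = (1::real)\<close>. The quotient is taken in the field of Laurent series.
\<close>

definition root_expr :: "real \<Rightarrow> real fls" where
  "root_expr s =
     (fls_const (s - 1) *
        (1 - fps_to_fls (fps_radical root 2
               (1 - fps_const (3 + s) * fps_X + fps_const (1 / 2 * (3 - s)) * fps_X ^ 2)))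
      - fls_const (1 + s) * fls_X)
     / (4 * fls_X)"

end

theory Submission
  imports Defs
begin

text \<open>
  Grow the permutations by inserting a new maximum. Inserting it between \<open>u\<close> and \<open>v\<close> is allowed
  if no entry of \<open>u\<close> exceeds two entries of \<open>v\<close> and no ascent \<open>a < b\<close> in \<open>u\<close> has an entry of \<open>v\<close>
  below \<open>a\<close>. Sites to the left of the new maximum keep their status; to the right of it, only the
  end of the permutation and possibly the gap before its last entry survive. The generating tree
  is therefore described by two integers, and the generating functions of its subtrees satisfy a
  linear recurrence with constant coefficients over the power series ring. Its characteristic
  polynomial factors over the golden ratio \<open>f\<close> and its conjugate \<open>g\<close>; the roots that are power
  series are \<open>1 + r\<close> and \<open>1 + t\<close> with \<open>r = x (1 + r) (1 + f r)\<close> and \<open>t = x (1 + t) (1 + g t)\<close>.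
\<close>

section \<open>Inserting a new maximum\<close>

lemma subseq_insert_iff:
  assumes "z \<notin> set xs"
  shows "subseq xs (u @ z # v) \<longleftrightarrow> subseq xs (u @ v)"
  using assms
proof (induction u arbitrary: xs)
  case Nil
  then show ?case by (cases xs) auto
next
  case (Cons x u)
  then show ?case by (cases xs) auto
qed

lemma subseq_set_mono: "subseq xs ys \<Longrightarrow> x \<in> set xs \<Longrightarrow> x \<in> set ys"
  by (auto simp: subseq_conv_nths dest: in_set_nthsD)

section \<open>The three patterns as one condition on four entries\<close>

text \<open>Having both \<open>c\<close> and \<open>d\<close> below \<open>a < b\<close> covers 3412
  and 3421 at once; the alternative \<open>b < c\<close> is 2341.\<close>

definition pattern_free :: "nat list \<Rightarrow> bool" where
  "pattern_free w \<longleftrightarrow>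
     (\<forall>a b c d. subseq [a, b, c, d] w \<longrightarrow> \<not> (a < b \<and> d < a \<and> (c < a \<or> b < c)))"

lemma pattern_freeD:
  assumes "pattern_free w" "subseq [a, b, c, d] w" "a < b" "d < a"
  shows "\<not> c < a" "\<not> b < c"
  using assms(1)[unfolded pattern_free_def, rule_format, OF assms(2)] assms(3,4) by auto

lemma avoids_iff_pattern_free:
  assumes "distinct w"
  shows "(\<forall>p \<in> {[3,4,1,2], [3,4,2,1], [2,3,4,1]}. avoids w p) \<longleftrightarrow> pattern_free w"
proof -
  have av: "avoids w p \<longleftrightarrow>
      (\<forall>a b c d. subseq [a, b, c, d] w \<longrightarrow> \<not> order_isomorphic [a, b, c, d] p)"
    if "length p = 4" for p
  proof -
    have "\<exists>a b c d. u = [a, b, c, d]" if "order_isomorphic u p" for u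
      using that \<open>length p = 4\<close>
      by (auto simp: order_isomorphic_def numeral_eq_Suc length_Suc_conv)
    then show ?thesis unfolding avoids_def by blast
  qed
  have iso1: "order_isomorphic [a, b, c, d] [3,4,1,2] \<longleftrightarrow> c < d \<and> d < a \<and> a < b" for a b c d
    by (simp add: order_isomorphic_def All_less_Suc2 numeral_eq_Suc) arith
  have iso2: "order_isomorphic [a, b, c, d] [3,4,2,1] \<longleftrightarrow> d < c \<and> c < a \<and> a < b" for a b c d
    by (simp add: order_isomorphic_def All_less_Suc2 numeral_eq_Suc) arith
  have iso3: "order_isomorphic [a, b, c, d] [2,3,4,1] \<longleftrightarrow> d < a \<and> a < b \<and> b < c" for a b c d
    by (simp add: order_isomorphic_def All_less_Suc2 numeral_eq_Suc) arith
  \<comment> \<open>The merged condition does not compare \<open>c\<close> with \<open>d\<close>;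
    distinctness splits it back into 3412 and 3421.\<close>
  have neq: "c \<noteq> d" if "subseq [a, b, c, d] w" for a b c d
  proof -
    from that obtain I where "[a, b, c, d] = nths w I" by (auto simp: subseq_conv_nths)
    then have "distinct [a, b, c, d]" using assms by (metis distinct_nthsI)
    then show ?thesis by simp
  qed
  have "(\<forall>p \<in> {[3,4,1,2], [3,4,2,1], [2,3,4,1]}. avoids w p) \<longleftrightarrow>
      (\<forall>a b c d. subseq [a, b, c, d] w \<longrightarrow>
        \<not> (c < d \<and> d < a \<and> a < b \<or> d < c \<and> c < a \<and> a < b \<or> d < a \<and> a < b \<and> b < c))"
  proof -
    have "avoids w [3,4,1,2] \<longleftrightarrow> (\<forall>a b c d. subseq [a, b, c, d] w \<longrightarrow> \<not> (c < d \<and> d < a \<and> a < b))"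
      using av[of "[3,4,1,2]"] unfolding iso1 by simp
    moreover have "avoids w [3,4,2,1] \<longleftrightarrow> (\<forall>a b c d. subseq [a, b, c, d] w \<longrightarrow> \<not> (d < c \<and> c < a \<and> a < b))"
      using av[of "[3,4,2,1]"] unfolding iso2 by simp
    moreover have "avoids w [2,3,4,1] \<longleftrightarrow> (\<forall>a b c d. subseq [a, b, c, d] w \<longrightarrow> \<not> (d < a \<and> a < b \<and> b < c))"
      using av[of "[2,3,4,1]"] unfolding iso3 by simp
    ultimately show ?thesis by (simp only: ball_simps simp_thms de_Morgan_disj imp_conjR all_conj_distrib)
  qed
  also have "\<dots> \<longleftrightarrow> pattern_free w"
  proof -
    have "(c < d \<and> d < a \<and> a < b \<or> d < c \<and> c < a \<and> a < b \<or> d < a \<and> a < b \<and> b < c) \<longleftrightarrow>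
        (a < b \<and> d < a \<and> (c < a \<or> b < c))" if "subseq [a, b, c, d] w" for a b c d
      using neq[OF that] by linarith
    then show ?thesis unfolding pattern_free_def by blast
  qed
  finally show ?thesis .
qed

section \<open>Effect of an insertion on active and good sites\<close>

text \<open>
  For \<open>m\<close> larger than all entries, \<open>active u v\<close> says that placing \<open>m\<close> between \<open>u\<close> and \<open>v\<close> creates
  no forbidden pattern, and \<open>good u v\<close> says that afterwards the gap just before the last entry
  stays active although it lies to the right of \<open>m\<close>.
\<close>

definition active :: "nat list \<Rightarrow> nat list \<Rightarrow> bool" where
  "active u v \<longleftrightarrow>
     (\<forall>a \<in> set u. \<forall>c d. subseq [c, d] v \<longrightarrow> \<not> (c < a \<and> d < a)) \<and>
     (\<forall>a b. subseq [a, b] u \<longrightarrow> a < b \<longrightarrow> (\<forall>d \<in> set v. a \<le> d))"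

lemma activeD1: "active u v \<Longrightarrow> a \<in> set u \<Longrightarrow> subseq [c, d] v \<Longrightarrow> \<not> (c < a \<and> d < a)"
  and activeD2: "active u v \<Longrightarrow> subseq [a, b] u \<Longrightarrow> a < b \<Longrightarrow> d \<in> set v \<Longrightarrow> a \<le> d"
  unfolding active_def by metis+

definition good :: "nat list \<Rightarrow> nat list \<Rightarrow> bool" where
  "good u v \<longleftrightarrow> active u v \<and> v \<noteq> [] \<and> (\<forall>a \<in> set u. a \<le> last v) \<and>
     (\<forall>a b. subseq [a, b] v \<longrightarrow> a < b \<longrightarrow> a \<le> last v)"

text \<open>A forbidden quadruple through \<open>m\<close> uses it as its largest entry: as
  \<open>b\<close> when \<open>c < a\<close>, or as \<open>c\<close> when \<open>b < c\<close>.
  These cases are the two clauses of \<open>active\<close>.\<close>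

lemma pattern_free_insert_max:
  assumes "\<forall>x \<in> set (u @ v). x < m"
  shows "pattern_free (u @ m # v) \<longleftrightarrow> pattern_free (u @ v) \<and> active u v"
proof (intro iffI conjI)
  assume pf: "pattern_free (u @ m # v)"
  have "subseq xs (u @ m # v)" if "subseq xs (u @ v)" for xs
    using that by (meson list_emb_append_mono list_emb_Cons subseq_order.order_refl subseq_order.order_trans)
  then show "pattern_free (u @ v)" using pf unfolding pattern_free_def by blast
  show "active u v"
    unfolding active_def
  proof (intro conjI ballI allI impI notI)
    fix a c d assume h: "a \<in> set u" "subseq [c, d] v" "c < a \<and> d < a"
    have "subseq ([a] @ [m, c, d]) (u @ m # v)"
      by (rule list_emb_append_mono) (use h in \<open>auto simp: subseq_singleton_left\<close>)
    moreover have "a < m" using h(1) assms by simp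
    ultimately show False using pattern_freeD[OF pf, of a m c d] h(3) by simp
  next
    fix a b d assume h: "subseq [a, b] u" "a < b" "d \<in> set v"
    have "subseq ([a, b] @ [m, d]) (u @ m # v)"
      by (rule list_emb_append_mono) (use h in \<open>auto simp: subseq_singleton_left\<close>)
    moreover have "b < m" using subseq_set_mono[OF h(1), of b] assms by simp
    ultimately show "a \<le> d" using pattern_freeD[OF pf, of a b m d] h(2) by force
  qed
next
  assume h: "pattern_free (u @ v) \<and> active u v"
  show "pattern_free (u @ m # v)"
    unfolding pattern_free_def
  proof (intro allI impI notI)
    fix a b c d assume s: "subseq [a, b, c, d] (u @ m # v)"
      and f: "a < b \<and> d < a \<and> (c < a \<or> b < c)"
    have le: "x \<le> m" if "x \<in> {a, b, c, d}" for x
      using subseq_set_mono[OF s, of x] that assms by (auto intro: less_imp_le)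
    show False
    proof (cases "m \<in> {b, c}")
      case False
      then have "m \<notin> set [a, b, c, d]" using f le[of b] by auto
      then have "subseq [a, b, c, d] (u @ v)" using subseq_insert_iff[THEN iffD1, OF _ s] by blast
      then show False using pattern_freeD[of "u @ v" a b c d] f h by blast
    next
      case True
      have nu: "m \<notin> set u" "m \<notin> set v" using assms by auto
      obtain x y where xy: "[a, b, c, d] = x @ y" "subseq x u" "subseq y (m # v)"
        using subseq_appendE[OF s] by metis
      have nx: "m \<notin> set x" using subseq_set_mono[OF xy(2)] nu by blast
      show False
      proof (cases "b = m")
        case True
        then have "x = [] \<or> x = [a]" using xy(1) nx by (auto simp: Cons_eq_append_conv)
        moreover have "x \<noteq> []"
        proof
          assume "x = []"
          then have y: "y = [a, b, c, d]" using xy(1) by simp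
          then have "subseq y v" using xy(3) f True by simp
          then show False using y True nu(2) subseq_set_mono[of y v b] by simp
        qed
        ultimately have x: "x = [a]" by blast
        then have "a \<in> set u" using xy(2) by (simp add: subseq_singleton_left)
        moreover have "y = [b, c, d]" using x xy(1) by auto
        then have "subseq [c, d] v" using xy(3) True by simp
        ultimately have "\<not> (c < a \<and> d < a)" using activeD1 h by blast
        then show False using f le[of c] True by simp
      next
        case False
        then have cm: "c = m" using True by simp
        then have "b < c" using f le[of b] False by auto
        have xs: "x = [] \<or> x = [a] \<or> x = [a, b]" using xy(1) nx cm by (auto simp: Cons_eq_append_conv)
        have x: "x = [a, b]"
        proof (rule ccontr)
          assume "x \<noteq> [a, b]"
          then have y: "y = [a, b, c, d] \<or> y = [b, c, d]"
            using xs xy(1) by auto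
          moreover have "a \<noteq> m" "b \<noteq> m" using f cm \<open>b < c\<close> by auto
          ultimately have "subseq y v" using xy(3) by auto
          then show False using y cm nu(2) subseq_set_mono[of y v c] by auto
        qed
        then have "y = [c, d]" using xy(1) by auto
        then have "d \<in> set v" using xy(3) cm by (simp add: subseq_singleton_left)
        moreover have "subseq [a, b] u" using x xy(2) by simp
        ultimately have "a \<le> d" using activeD2 h f by blast
        then show False using f by simp
      qed
    qed
  qed
qed

text \<open>Both clauses of \<open>active\<close> concern right-hand entries below some entry of
  \<open>u1\<close>, and \<open>m\<close> exceeds all of these.\<close>

lemma active_insert_right:
  assumes "\<forall>x \<in> set (u2 @ v). x < m" and "\<forall>x \<in> set u1. x < m"
  shows "active u1 (u2 @ m # v) \<longleftrightarrow> active u1 (u2 @ v)"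
proof -
  have 1: "subseq [c, d] (u2 @ m # v) \<longleftrightarrow> subseq [c, d] (u2 @ v)" if "a \<in> set u1" "c < a \<and> d < a" for a c d
    using that assms(2) by (intro subseq_insert_iff) auto
  have 2: "a \<le> m" if "subseq [a, b] u1" for a b
    using subseq_set_mono[OF that, of a] assms(2) by force
  have "(\<forall>d \<in> set (u2 @ m # v). a \<le> d) \<longleftrightarrow> (\<forall>d \<in> set (u2 @ v). a \<le> d)" if "subseq [a, b] u1" for a b
    using 2[OF that] by auto
  moreover have "(\<forall>c d. subseq [c, d] (u2 @ m # v) \<longrightarrow> \<not> (c < a \<and> d < a)) \<longleftrightarrow>
      (\<forall>c d. subseq [c, d] (u2 @ v) \<longrightarrow> \<not> (c < a \<and> d < a))" if "a \<in> set u1" for a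
    using 1[OF that] by blast
  ultimately show ?thesis unfolding active_def by simp
qed

text \<open>With \<open>m\<close> on the left, any two entries of \<open>v2\<close> violate the
  first clause. If \<open>v2\<close> is a single entry \<open>c\<close>, the ascents
  \<open>a < m\<close> with \<open>a\<close> in \<open>u\<close> and those inside \<open>v1\<close>
  demand \<open>a \<le> c\<close>, which is \<open>good\<close>.\<close>

lemma active_insert_left:
  assumes "\<forall>x \<in> set (u @ v1 @ v2). x < m" and "active u (v1 @ v2)"
  shows "active (u @ m # v1) v2 \<longleftrightarrow> v2 = [] \<or> (length v2 = 1 \<and> good u (v1 @ v2))"
proof
  assume act: "active (u @ m # v1) v2"
  show "v2 = [] \<or> (length v2 = 1 \<and> good u (v1 @ v2))"
  proof (rule disjCI)
    assume ne: "\<not> (length v2 = 1 \<and> good u (v1 @ v2))"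
    show "v2 = []"
    proof (rule ccontr)
      assume "v2 \<noteq> []"
      then obtain c v3 where c: "v2 = c # v3" by (cases v2) auto
      have "v3 = []"
      proof (rule ccontr)
        assume "v3 \<noteq> []"
        then obtain d v4 where "v3 = d # v4" by (cases v3) auto
        then have "subseq [c, d] v2" "c < m" "d < m" using c assms by auto
        then show False using act unfolding active_def by auto
      qed
      then have c: "v2 = [c]" using c by simp
      have "a \<le> c" if "a \<in> set u" for a
      proof -
        have "subseq ([a] @ [m]) (u @ m # v1)"
          by (rule list_emb_append_mono) (use that in \<open>auto simp: subseq_singleton_left\<close>)
        then show ?thesis using act c assms that unfolding active_def by auto
      qed
      moreover have "a \<le> c" if "subseq [a, b] (v1 @ [c])" "a < b" for a b
      proof (cases "subseq [a, b] v1")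
        case True
        then have "subseq [a, b] (u @ m # v1)" by auto
        then show ?thesis using act c that unfolding active_def by auto
      next
        case False
        \<comment> \<open>\<open>good\<close> also ranges over ascents ending in the last entry
          itself, where the bound is immediate.\<close>
        then have "b = c"
          using that(1) by (auto simp: subseq_append_iff Cons_eq_append_conv split: if_splits)
        then show ?thesis using that by simp
      qed
      ultimately show False using ne assms c unfolding good_def by auto
    qed
  qed
next
  assume "v2 = [] \<or> (length v2 = 1 \<and> good u (v1 @ v2))"
  then show "active (u @ m # v1) v2"
  proof
    assume "v2 = []" then show ?thesis by (simp add: active_def)
  next
    assume h: "length v2 = 1 \<and> good u (v1 @ v2)"
    then obtain c where c: "v2 = [c]" by (auto simp: length_Suc_conv)
    have "a \<le> c" if s: "subseq [a, b] (u @ m # v1)" "a < b" for a b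
    proof (rule ccontr)
      assume ac: "\<not> a \<le> c"
      then have au: "a \<notin> set u" using h c unfolding good_def by auto
      have "b \<le> m" using subseq_set_mono[OF s(1), of b] assms(1) by (auto intro: less_imp_le)
      then have "a < m" using s(2) by simp
      have "subseq [a, b] (m # v1)"
        using s(1) au by (auto simp: subseq_append_iff Cons_eq_append_conv dest: subseq_set_mono)
      then have "subseq [a, b] v1" using \<open>a < m\<close> by auto
      then have "subseq [a, b] (v1 @ v2)" by auto
      then show False using h s ac c unfolding good_def by auto
    qed
    moreover have "\<not> subseq [x, y] v2" for x y using c by auto
    ultimately show ?thesis using c unfolding active_def by simp
  qed
qed

text \<open>Every entry of \<open>u2\<close> now starts an ascent to \<open>m\<close>, and no ascent
  starts at \<open>m\<close>. Apart from activity, the right-hand side is the condition for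
  \<open>good (u1 @ u2) v\<close>.\<close>

lemma good_insert_right:
  assumes "\<forall>x \<in> set (u1 @ u2 @ v). x < m" and "v \<noteq> []"
  shows "good u1 (u2 @ m # v) \<longleftrightarrow> active u1 (u2 @ v) \<and> 
     (\<forall>a \<in> set (u1 @ u2). a \<le> last v) \<and> (\<forall>a b. subseq [a, b] v \<longrightarrow> a < b \<longrightarrow> a \<le> last v)"
proof -
  have act: "active u1 (u2 @ m # v) \<longleftrightarrow> active u1 (u2 @ v)"
    using assms by (intro active_insert_right) auto
  have 1: "subseq [a, m] (u2 @ m # v)" if "a \<in> set u2" for a
  proof -
    have "subseq ([a] @ [m]) (u2 @ m # v)"
      by (rule list_emb_append_mono) (use that in \<open>auto simp: subseq_singleton_left\<close>)
    then show ?thesis by simp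
  qed
  have 2: "subseq [a, b] (u2 @ m # v)" if "subseq [a, b] v" for a b
    using that by auto
  have 3: "a \<in> set u2 \<or> subseq [a, b] v" if "subseq [a, b] (u2 @ m # v)" "a < b" for a b
  proof (rule disjCI)
    assume n: "\<not> subseq [a, b] v"
    then have "a = m \<and> b \<in> set v \<or> a \<in> set u2"
      using that(1)
      by (auto simp: subseq_append_iff Cons_eq_append_conv subseq_singleton_left
          dest: subseq_set_mono split: if_splits)
    moreover have "\<forall>x \<in> set v. x < m" using assms(1) by simp
    ultimately show "a \<in> set u2" using that(2) by (blast dest: less_asym)
  qed
  have last: "last (u2 @ m # v) = last v" using assms(2) by simp
  have le: "\<forall>a \<in> set u2. a < m" using assms(1) by simp
  show ?thesis (is "_ \<longleftrightarrow> ?R")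
  proof
    assume g: "good u1 (u2 @ m # v)"
    have "a \<le> last v" if "a \<in> set u2" for a
      using g 1[OF that] that le unfolding good_def last by blast
    then have "\<forall>a \<in> set (u1 @ u2). a \<le> last v"
      using g unfolding good_def last by auto
    moreover have "\<forall>a b. subseq [a, b] v \<longrightarrow> a < b \<longrightarrow> a \<le> last v"
      using g 2 unfolding good_def last by blast
    ultimately show ?R using g unfolding good_def act by blast
  next
    assume r: ?R
    then have "a \<le> last v" if "subseq [a, b] (u2 @ m # v)" "a < b" for a b
      using 3[OF that] that by auto
    then show "good u1 (u2 @ m # v)" using r unfolding good_def last act by auto
  qed
qed

text \<open>Moving the site left across \<open>u2\<close> adds only ascents starting in
  \<open>u2\<close>, whose entries \<open>last v\<close> already bounds. Activity can be lost, hence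
  the second assumption.\<close>

lemma good_append_left:
  assumes "good (u1 @ u2) v" and "active u1 (u2 @ v)"
  shows "good u1 (u2 @ v)"
proof -
  have "a \<in> set u2 \<or> subseq [a, b] v" if "subseq [a, b] (u2 @ v)" for a b
    using that
    by (auto simp: subseq_append_iff Cons_eq_append_conv subseq_singleton_left
        dest: subseq_set_mono)
  moreover have "last (u2 @ v) = last v" "v \<noteq> []" "\<forall>a \<in> set u1 \<union> set u2. a \<le> last v"
      "\<forall>a b. subseq [a, b] v \<longrightarrow> a < b \<longrightarrow> a \<le> last v"
    using assms(1) unfolding good_def by auto
  ultimately show ?thesis using assms(2) unfolding good_def by (metis UnCI append_is_Nil_conv)
qed

section \<open>The generating tree\<close>

definition sites :: "nat list \<Rightarrow> nat set" where
  "sites w = {p. p \<le> length w \<and> active (take p w) (drop p w)}"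

definition good_sites :: "nat list \<Rightarrow> nat set" where
  "good_sites w = {p. p \<le> length w \<and> good (take p w) (drop p w)}"

definition insert_max :: "nat \<Rightarrow> nat list \<Rightarrow> nat list" where
  "insert_max p w = take p w @ Suc (length w) # drop p w"

lemma finite_sites: "finite (sites w)" and finite_good_sites: "finite (good_sites w)"
  by (auto simp: sites_def good_sites_def intro: finite_subset[of _ "{..length w}"])

lemma length_in_sites: "length w \<in> sites w"
  by (simp add: sites_def active_def)

lemma good_sites_subset: "good_sites w \<subseteq> sites w"
  by (auto simp: sites_def good_sites_def good_def)

lemma length_notin_good_sites: "length w \<notin> good_sites w"
  by (simp add: good_sites_def good_def)

lemma drop_split: "q \<le> p \<Longrightarrow> drop q w = drop q (take p w) @ drop p w"
  by (metis append_take_drop_id drop_drop drop_take le_add_diff_inverse2)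

lemma take_split: "q \<le> p \<Longrightarrow> take p w = take q w @ drop q (take p w)"
  by (metis append_take_drop_id min.absorb1 take_take)

text \<open>Makes the good sites an initial segment of the active ones, so that two cardinalities
  suffice as a label.\<close>

lemma good_sites_downward_closed:
  assumes "p \<in> good_sites w" "q \<in> sites w" "q \<le> p"
  shows "q \<in> good_sites w"
  using assms good_append_left[of "take q w" "drop q (take p w)" "drop p w"]
  by (simp add: sites_def good_sites_def flip: take_split drop_split)

lemma insert_max_take_drop_le:
  assumes "q \<le> p" "p \<le> length w"
  shows "take q (insert_max p w) = take q w"
    and "drop q (insert_max p w) = drop q (take p w) @ Suc (length w) # drop p w"
  using assms by (auto simp: insert_max_def min_def)

lemma insert_max_take_drop_gt:
  assumes "p < q" "q \<le> Suc (length w)"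
  shows "take q (insert_max p w) = take p w @ Suc (length w) # take (q - Suc p) (drop p w)"
    and "drop q (insert_max p w) = drop (q - Suc p) (drop p w)"
  using assms by (auto simp: insert_max_def min_def take_Cons' drop_Cons')

lemma length_insert_max [simp]: "p \<le> length w \<Longrightarrow> length (insert_max p w) = Suc (length w)"
  by (simp add: insert_max_def)

text \<open>The new word has length \<open>Suc (length w)\<close>, so position
  \<open>length w\<close> is the gap before its last entry.\<close>

lemma sites_insert_max:
  assumes w: "\<forall>x \<in> set w. x \<le> length w" and p: "p \<in> sites w"
  shows "sites (insert_max p w) =
           {q \<in> sites w. q \<le> p} \<union> (if p \<in> good_sites w then {length w} else {}) \<union> {Suc (length w)}"
    (is "_ = ?R")
proof (intro set_eqI)
  fix q
  let ?n = "length w"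
  have pn: "p \<le> ?n" and act: "active (take p w) (drop p w)" using p by (auto simp: sites_def)
  have lt: "\<forall>x \<in> set w. x < Suc ?n" using w by (simp add: less_Suc_eq_le)
  show "q \<in> sites (insert_max p w) \<longleftrightarrow> q \<in> ?R"
  proof (cases "q \<le> p")
    case True
    have "active (take q w) (drop q (take p w) @ Suc ?n # drop p w) \<longleftrightarrow>
        active (take q w) (drop q (take p w) @ drop p w)"
      using lt by (intro active_insert_right) (auto dest: in_set_takeD in_set_dropD)
    then show ?thesis
      using True pn length_notin_good_sites[of w]
      by (auto simp: sites_def insert_max_take_drop_le drop_split[OF True, of w])
  next
    case False
    have "q \<in> sites (insert_max p w) \<longleftrightarrow> q = Suc ?n \<or> (q = ?n \<and> p \<in> good_sites w)"
    proof (cases "q \<le> Suc ?n")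
      case True
      let ?v1 = "take (q - Suc p) (drop p w)" and ?v2 = "drop (q - Suc p) (drop p w)"
      have "active (take p w @ Suc ?n # ?v1) ?v2 \<longleftrightarrow>
          ?v2 = [] \<or> (length ?v2 = 1 \<and> good (take p w) (?v1 @ ?v2))"
        using lt act by (intro active_insert_left) (auto simp del: drop_drop dest: in_set_takeD in_set_dropD)
      then have "active (take p w @ Suc ?n # ?v1) ?v2 \<longleftrightarrow>
          ?v2 = [] \<or> (length ?v2 = 1 \<and> good (take p w) (drop p w))"
        unfolding append_take_drop_id .
      moreover have "?v2 = [] \<longleftrightarrow> q = Suc ?n" "length ?v2 = 1 \<longleftrightarrow> q = ?n"
        using True False pn by auto
      ultimately show ?thesis
        using True False pn
        by (auto simp: sites_def good_sites_def insert_max_take_drop_gt)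
    qed (use pn in \<open>auto simp: sites_def\<close>)
    then show ?thesis using False by auto
  qed
qed

text \<open>A maximum at the end bounds everything, so all old active sites become good. Otherwise
  the last entry is unchanged and \<open>good_insert_right\<close> ties the sites up to
  \<open>p\<close> to the goodness of \<open>p\<close>; sites right of the maximum fail because the
  last entry is smaller.\<close>

lemma good_sites_insert_max:
  assumes w: "\<forall>x \<in> set w. x \<le> length w" and p: "p \<in> sites w"
  shows "good_sites (insert_max p w) =
           (if p = length w then sites w
            else if p \<in> good_sites w then {q \<in> sites w. q \<le> p} else {})"
    (is "_ = ?R")
proof (intro set_eqI)
  fix q
  let ?n = "length w"
  have pn: "p \<le> ?n" and act: "active (take p w) (drop p w)" using p by (auto simp: sites_def)
  have lt: "\<forall>x \<in> set w. x < Suc ?n" using w by (simp add: less_Suc_eq_le)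
  have R: "q \<in> ?R \<Longrightarrow> q \<le> p" by (auto simp: sites_def split: if_splits)
  show "q \<in> good_sites (insert_max p w) \<longleftrightarrow> q \<in> ?R"
  proof (cases "q \<le> p")
    case True
    let ?u = "drop q (take p w)"
    have eq: "q \<in> good_sites (insert_max p w) \<longleftrightarrow> good (take q w) (?u @ Suc ?n # drop p w)"
      using True pn by (simp add: good_sites_def insert_max_take_drop_le)
    have sq: "q \<in> sites w \<longleftrightarrow> active (take q w) (?u @ drop p w)"
      using True pn by (simp add: sites_def drop_split[OF True, of w])
    show ?thesis
    proof (cases "p = ?n")
      case pn: True
      have "active (take q w) (?u @ Suc ?n # drop p w) \<longleftrightarrow> active (take q w) (?u @ drop p w)"
        using lt by (intro active_insert_right) (auto dest: in_set_takeD in_set_dropD)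
      moreover have "a \<le> Suc ?n" if "subseq [a, b] (?u @ [Suc ?n])" for a b
        using subseq_set_mono[OF that, of a] lt by (auto dest!: in_set_takeD in_set_dropD)
      moreover have "\<forall>a \<in> set (take q w). a \<le> Suc ?n"
        using lt by (auto dest!: in_set_takeD intro: less_imp_le)
      ultimately show ?thesis
        unfolding eq using pn sq by (auto simp: good_def)
    next
      case False
      have "good (take q w) (?u @ Suc ?n # drop p w) \<longleftrightarrow> active (take q w) (?u @ drop p w) \<and>
          (\<forall>a \<in> set (take q w @ ?u). a \<le> last (drop p w)) \<and>
          (\<forall>a b. subseq [a, b] (drop p w) \<longrightarrow> a < b \<longrightarrow> a \<le> last (drop p w))"
        using lt False pn by (intro good_insert_right) (auto dest: in_set_takeD in_set_dropD)
      also have "\<dots> \<longleftrightarrow> q \<in> sites w \<and> p \<in> good_sites w"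
        using False pn act unfolding sq good_sites_def good_def take_split[OF True, of w, symmetric] by simp
      finally show ?thesis unfolding eq using False True by auto
    qed
  next
    case False
    have "\<not> good (take q (insert_max p w)) (drop q (insert_max p w))" if "q \<le> Suc ?n"
    proof
      assume g: "good (take q (insert_max p w)) (drop q (insert_max p w))"
      let ?v = "drop (q - Suc p) (drop p w)"
      have "?v \<noteq> []" "Suc ?n \<le> last ?v"
        using g False that by (auto simp: insert_max_take_drop_gt good_def)
      moreover have "last ?v \<in> set w"
        using last_in_set[OF \<open>?v \<noteq> []\<close>] by (meson in_set_dropD)
      ultimately show False using lt by auto
    qed
    then show ?thesis using R False pn by (auto simp: good_sites_def)
  qed
qed

text \<open>The labels of children involve ranks of sites rather than positions; this passes from
  one to the other.\<close>

lemma sum_rank: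
  fixes S :: "'a::linorder set"
  assumes "finite S"
  shows "(\<Sum>p\<in>S. f (card {q \<in> S. q \<le> p})) = (\<Sum>i = 1..card S. f i)"
  using assms
proof (induction S rule: finite_linorder_max_induct)
  case empty
  then show ?case by simp
next
  case (insert b S)
  have "{q \<in> insert b S. q \<le> b} = insert b S" using insert by auto
  moreover have "{q \<in> insert b S. q \<le> p} = {q \<in> S. q \<le> p}" if "p \<in> S" for p
    using insert that by auto
  ultimately show ?case using insert by (auto simp: add.commute)
qed

text \<open>
  A permutation with \<open>k\<close> active sites, the first \<open>j\<close> of which are good, has children with the
  labels \<open>(k + 1, k)\<close> from the last site, \<open>(i + 2, i)\<close> from the \<open>i\<close>-th site when it is good, and
  \<open>(i + 1, 0)\<close> from the others.
\<close>

lemma sum_sites_insert_max: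
  fixes f :: "nat \<Rightarrow> nat \<Rightarrow> nat"
  assumes w: "\<forall>x \<in> set w. x \<le> length w"
  defines "k \<equiv> card (sites w)" and "j \<equiv> card (good_sites w)"
  shows "(\<Sum>p\<in>sites w. f (card (sites (insert_max p w))) (card (good_sites (insert_max p w)))) =
           f (Suc k) k + (\<Sum>i\<in>{Suc j..<k}. f (Suc i) 0) + (\<Sum>i = 1..j. f (i + 2) i)"
proof -
  let ?n = "length w" and ?S = "sites w" and ?H = "good_sites w"
  \<comment> \<open>The active sites that are neither good nor last; their ranks run from
    \<open>j + 1\<close> to \<open>k - 1\<close>.\<close>
  let ?M = "?S - ?H - {?n}"
  let ?r = "\<lambda>p. card {q \<in> ?S. q \<le> p}"
  let ?f = "\<lambda>p. f (card (sites (insert_max p w))) (card (good_sites (insert_max p w)))"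
  note fin = finite_sites[of w] finite_good_sites[of w]
  have le: "q \<le> ?n" if "q \<in> ?S" for q using that by (simp add: sites_def)
  have S: "?S = insert ?n (?H \<union> ?M)"
    using length_in_sites[of w] good_sites_subset[of w] by auto
  have k: "k = Suc (j + card ?M)"
    unfolding k_def j_def
    by (subst S, subst card_insert_disjoint)
       (use fin length_notin_good_sites[of w] in \<open>auto intro: card_Un_disjoint\<close>)
  have c1: "card (sites (insert_max p w)) = ?r p + (if p \<in> ?H then 2 else 1)" if "p \<in> ?S" for p
  proof -
    have "?n \<notin> {q \<in> ?S. q \<le> p}" if "p \<in> ?H"
      using that \<open>p \<in> ?S\<close> le[of p] length_notin_good_sites[of w] by (cases "p = ?n") auto
    moreover have "Suc ?n \<notin> {q \<in> ?S. q \<le> p}" using le by force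
    ultimately show ?thesis
      unfolding sites_insert_max[OF w that] using fin by auto
  qed
  have n: "?f ?n = f (Suc k) k"
  proof -
    have "{q \<in> ?S. q \<le> ?n} = ?S" using le by auto
    then show ?thesis
      using c1[of ?n] length_in_sites[of w] length_notin_good_sites[of w]
      by (simp add: good_sites_insert_max[OF w] k_def)
  qed
  have H: "?f p = f (card {q \<in> ?H. q \<le> p} + 2) (card {q \<in> ?H. q \<le> p})" if "p \<in> ?H" for p
  proof -
    have "p \<in> ?S" "p \<noteq> ?n" using that good_sites_subset length_notin_good_sites by auto
    moreover have "{q \<in> ?S. q \<le> p} = {q \<in> ?H. q \<le> p}"
      using that good_sites_downward_closed good_sites_subset by blast
    ultimately show ?thesis using that by (simp add: c1 good_sites_insert_max[OF w])
  qed
  have M: "?f p = f (Suc (j + card {q \<in> ?M. q \<le> p})) 0" if "p \<in> ?M" for p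
  proof -
    have "q \<le> p" if "q \<in> ?H" for q
      using that \<open>p \<in> ?M\<close> good_sites_downward_closed[of q w p] by (cases "q \<le> p") auto
    moreover have "q \<noteq> ?n" if "q \<le> p" for q
      using that \<open>p \<in> ?M\<close> le[of p] by auto
    ultimately have "{q \<in> ?S. q \<le> p} = ?H \<union> {q \<in> ?M. q \<le> p}"
      using good_sites_subset[of w] by auto
    then have "?r p = j + card {q \<in> ?M. q \<le> p}"
      unfolding j_def using fin by (auto intro: card_Un_disjoint)
    then show ?thesis using that by (simp add: c1 good_sites_insert_max[OF w])
  qed
  have "(\<Sum>p\<in>?M. ?f p) = (\<Sum>i = 1..card ?M. f (Suc (j + i)) 0)"
    using M sum_rank[of ?M "\<lambda>i. f (Suc (j + i)) 0"] fin by simp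
  also have "\<dots> = (\<Sum>i\<in>{Suc j..<k}. f (Suc i) 0)"
    by (rule sum.reindex_bij_witness[of _ "\<lambda>i. i - j" "\<lambda>i. j + i"]) (auto simp: k)
  finally have M': "(\<Sum>p\<in>?M. ?f p) = (\<Sum>i\<in>{Suc j..<k}. f (Suc i) 0)" .
  have H': "(\<Sum>p\<in>?H. ?f p) = (\<Sum>i = 1..j. f (i + 2) i)"
    using H sum_rank[of ?H "\<lambda>i. f (i + 2) i"] fin by (simp add: j_def)
  have "(\<Sum>p\<in>?S. ?f p) = ?f ?n + (\<Sum>p\<in>?H \<union> ?M. ?f p)"
    by (subst S, rule sum.insert) (use fin length_notin_good_sites[of w] in auto)
  also have "(\<Sum>p\<in>?H \<union> ?M. ?f p) = (\<Sum>p\<in>?H. ?f p) + (\<Sum>p\<in>?M. ?f p)"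
    by (rule sum.union_disjoint) (use fin in auto)
  finally show ?thesis unfolding n H' M' by simp
qed

section \<open>Counting the permutations by levels of the tree\<close>

definition pattern_free_perms :: "nat \<Rightarrow> nat list set" where
  "pattern_free_perms n = {w \<in> permutations_of_set {1..n}. pattern_free w}"

lemma avoiding_perms_eq:
  "avoiding_perms n {[3,4,1,2], [3,4,2,1], [2,3,4,1]} = pattern_free_perms n"
  unfolding avoiding_perms_def pattern_free_perms_def
  using avoids_iff_pattern_free by (auto dest: permutations_of_setD)

lemma finite_pattern_free_perms: "finite (pattern_free_perms n)"
  by (simp add: pattern_free_perms_def)

lemma pattern_free_permsD:
  assumes "w \<in> pattern_free_perms n"
  shows "set w = {1..n}" "distinct w" "length w = n" "pattern_free w" "\<forall>x \<in> set w. x \<le> length w"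
proof -
  show "set w = {1..n}" "distinct w" "pattern_free w"
    using assms by (auto simp: pattern_free_perms_def dest: permutations_of_setD)
  then show "length w = n" using distinct_card by fastforce
  then show "\<forall>x \<in> set w. x \<le> length w" using \<open>set w = {1..n}\<close> by simp
qed

text \<open>Deleting the entry \<open>Suc n\<close> is the inverse map, and its position recovers
  the site.\<close>

lemma bij_betw_insert_max:
  "bij_betw (\<lambda>(w, p). insert_max p w) (Sigma (pattern_free_perms n) sites)
     (pattern_free_perms (Suc n))"
proof (rule bij_betw_imageI)
  show "inj_on (\<lambda>(w, p). insert_max p w) (Sigma (pattern_free_perms n) sites)"
  proof (rule inj_onI, clarify)
    fix w p w' p'
    assume h: "w \<in> pattern_free_perms n" "w' \<in> pattern_free_perms n" "p \<in> sites w" "p' \<in> sites w'"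
      and eq: "insert_max p w = insert_max p' w'"
    have "Suc n \<notin> set (take p w)" "Suc n \<notin> set (drop p w)"
      using h(1) by (auto dest!: in_set_takeD in_set_dropD simp: pattern_free_permsD(1))
    moreover have "take p w @ Suc n # drop p w = take p' w' @ Suc n # drop p' w'"
      using eq h by (simp add: insert_max_def pattern_free_permsD(3))
    ultimately have tk: "take p w = take p' w'" and dr: "drop p w = drop p' w'"
      by (simp_all add: append_Cons_eq_iff)
    then have "w = w'" by (metis append_take_drop_id)
    moreover have "p = p'"
      using arg_cong[OF tk, of length] h by (simp add: sites_def pattern_free_permsD(3))
    ultimately show "w = w' \<and> p = p'" by simp
  qed
  show "(\<lambda>(w, p). insert_max p w) ` Sigma (pattern_free_perms n) sites = pattern_free_perms (Suc n)"
  proof (intro equalityI subsetI)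
    fix w' assume "w' \<in> (\<lambda>(w, p). insert_max p w) ` Sigma (pattern_free_perms n) sites"
    then obtain w p where w': "w' = insert_max p w" and w: "w \<in> pattern_free_perms n" and p: "p \<in> sites w"
      by auto
    note D = pattern_free_permsD[OF w]
    have "set w' = insert (Suc n) (set w)"
      unfolding w' insert_max_def using D(3)
      by (metis append_take_drop_id list.simps(15) set_append Un_insert_right)
    moreover have "distinct w'"
      using D(1,2,3) distinct_append[of "take p w" "drop p w"]
      by (auto simp: w' insert_max_def dest: in_set_takeD in_set_dropD)
    moreover have "pattern_free w'"
      unfolding w' insert_max_def using D(4,5) p
      by (subst pattern_free_insert_max) (auto simp: sites_def less_Suc_eq_le simp flip: set_append)
    ultimately show "w' \<in> pattern_free_perms (Suc n)"
      using D(1) by (auto simp: pattern_free_perms_def permutations_of_set_def)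
  next
    fix w' assume w': "w' \<in> pattern_free_perms (Suc n)"
    note D = pattern_free_permsD[OF w']
    have "Suc n \<in> set w'" using D(1) by simp
    then obtain u v where uv: "w' = u @ Suc n # v" by (meson split_list)
    have S: "set (u @ v) = {1..n}"
    proof -
      have "insert (Suc n) (set (u @ v)) = insert (Suc n) {1..n}"
        using D(1) uv by (auto simp: atLeastAtMostSuc_conv)
      moreover have "Suc n \<notin> set (u @ v)" using D(2) uv by auto
      ultimately show ?thesis by (metis insert_ident atLeastAtMost_iff not_less_eq_eq order_refl)
    qed
    have len: "length (u @ v) = n" using D(3) uv by simp
    have "pattern_free (u @ v) \<and> active u v"
      using D(4) S pattern_free_insert_max[of u v "Suc n"] by (auto simp: uv)
    moreover have "distinct (u @ v)" using D(2) uv by auto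
    ultimately have "u @ v \<in> pattern_free_perms n" "length u \<in> sites (u @ v)"
      using S by (auto simp: pattern_free_perms_def permutations_of_set_def sites_def)
    moreover have "w' = insert_max (length u) (u @ v)"
      using uv len by (simp add: insert_max_def)
    ultimately show "w' \<in> (\<lambda>(w, p). insert_max p w) ` Sigma (pattern_free_perms n) sites"
      by force
  qed
qed

text \<open>The number of nodes \<open>m\<close> levels below a node labelled \<open>(k, j)\<close>.\<close>

fun descendants :: "nat \<Rightarrow> nat \<Rightarrow> nat \<Rightarrow> nat" where
  "descendants 0 k j = 1"
| "descendants (Suc m) k j =
     descendants m (Suc k) k + (\<Sum>i\<in>{Suc j..<k}. descendants m (Suc i) 0) +
     (\<Sum>i = 1..j. descendants m (i + 2) i)"

text \<open>The labels of the children depend only on the label of the parent. The induction peels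
  off the top level, so its hypothesis is applied at \<open>Suc n\<close>.\<close>

lemma card_pattern_free_perms_add:
  "card (pattern_free_perms (n + m)) =
     (\<Sum>w\<in>pattern_free_perms n. descendants m (card (sites w)) (card (good_sites w)))"
proof (induction m arbitrary: n)
  case 0
  show ?case by simp
next
  case (Suc m)
  let ?d = "\<lambda>w. descendants m (card (sites w)) (card (good_sites w))"
  have "card (pattern_free_perms (n + Suc m)) = (\<Sum>w\<in>pattern_free_perms (Suc n). ?d w)"
    using Suc[of "Suc n"] by simp
  also have "\<dots> = (\<Sum>(w, p)\<in>Sigma (pattern_free_perms n) sites. ?d (insert_max p w))"
    using sum.reindex_bij_betw[OF bij_betw_insert_max, of ?d n] by (simp add: case_prod_unfold)
  also have "\<dots> = (\<Sum>w\<in>pattern_free_perms n. \<Sum>p\<in>sites w. ?d (insert_max p w))"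
    by (rule sum.Sigma[symmetric]) (auto simp: finite_pattern_free_perms finite_sites)
  also have "\<dots> = (\<Sum>w\<in>pattern_free_perms n. descendants (Suc m) (card (sites w)) (card (good_sites w)))"
    by (rule sum.cong) (auto simp: sum_sites_insert_max pattern_free_permsD(5))
  finally show ?case .
qed

lemma card_pattern_free_perms: "card (pattern_free_perms m) = descendants m 1 0"
proof -
  have "pattern_free_perms 0 = {[]}" by (auto simp: pattern_free_perms_def pattern_free_def)
  moreover have "sites [] = {0}" "good_sites [] = {}"
    by (auto simp: sites_def good_sites_def active_def good_def)
  ultimately show ?thesis using card_pattern_free_perms_add[of 0 m] by simp
qed

section \<open>Generating functions of the subtrees\<close>

text \<open>
  Only the labels \<open>(j + 1, j)\<close>, \<open>(j + 2, j)\<close> and \<open>(j + 1, 0)\<close> occur; \<open>\<alpha> j\<close>, \<open>\<beta> j\<close> and \<open>\<gamma> j\<close> are the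
  generating functions of the corresponding subtrees. Here \<open>f\<close> is the golden ratio and \<open>g\<close> its
  conjugate, \<open>1 + r\<close> and \<open>1 + t\<close> are the characteristic roots of the recurrence that are power
  series, and \<open>p\<close>, \<open>q\<close> are fixed by the initial conditions.
\<close>

locale kernel_roots =
  fixes x r t f g p q :: "'a::comm_ring_1"
  assumes fg: "f + g = 1" "f * g = -1"
    and r: "r = x * (1 + r) * (1 + f * r)" and t: "t = x * (1 + t) * (1 + g * t)"
    and pq1: "(1 - g * r) * p + (1 - f * t) * q = 1" and pq2: "g * p + f * q = -1"
begin

definition \<alpha> :: "nat \<Rightarrow> 'a" where
  "\<alpha> j = p * (1 + f * r) * (1 + r) ^ j + q * (1 + g * t) * (1 + t) ^ j"

definition \<beta> :: "nat \<Rightarrow> 'a" where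
  "\<beta> j = p * (1 + f * r) * (1 - g * r) * (1 + r) ^ j + q * (1 + g * t) * (1 - f * t) * (1 + t) ^ j"

definition \<gamma> :: "nat \<Rightarrow> 'a" where
  "\<gamma> j = - g * p * (1 + f * r) * (1 + r) ^ j - f * q * (1 + g * t) * (1 + t) ^ j"

lemma g_eq: "g = 1 - f"
  using fg(1) by (metis add_diff_cancel_left')

lemma fg_mult: "f * (g * y) = - y" "g * (f * y) = - y"
  using fg(2) by (metis mult.assoc mult.commute mult_minus1)+

text \<open>The equations for \<open>r\<close> and \<open>t\<close> turn
  \<open>x * \<alpha> 1\<close> into \<open>p * r + q * t\<close>; \<open>pq1\<close> evaluates the
  rest, as \<open>pq2\<close> does in \<open>gamma_0\<close>.\<close>

lemma alpha_0: "\<alpha> 0 = 1 + x * \<alpha> 1"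
proof -
  have "\<alpha> 0 - x * \<alpha> 1 = p * (1 + f * r) + q * (1 + g * t)
      - p * (x * (1 + r) * (1 + f * r)) - q * (x * (1 + t) * (1 + g * t))"
    by (simp add: \<alpha>_def algebra_simps)
  also have "\<dots> = p * (1 + f * r - r) + q * (1 + g * t - t)"
    unfolding r[symmetric] t[symmetric] by (simp add: algebra_simps)
  also have "\<dots> = (1 - g * r) * p + (1 - f * t) * q"
    by (simp add: g_eq algebra_simps)
  finally show ?thesis unfolding pq1 by (simp add: diff_eq_eq)
qed

lemma gamma_0: "\<gamma> 0 = 1 + x * \<alpha> 1"
proof -
  have "\<gamma> 0 - x * \<alpha> 1 = - g * p - f * q - (f * g) * (p * r + q * t)
      - p * (x * (1 + r) * (1 + f * r)) - q * (x * (1 + t) * (1 + g * t))"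
    by (simp add: \<alpha>_def \<gamma>_def algebra_simps)
  also have "\<dots> = - (g * p + f * q)"
    unfolding r[symmetric] t[symmetric] fg by (simp add: algebra_simps)
  finally show ?thesis unfolding pq2 by (simp add: diff_eq_eq)
qed

text \<open>Differencing \<open>alpha_rec\<close> in \<open>j\<close> removes its sum; what remains
  is checked on the powers of \<open>1 + r\<close> and \<open>1 + t\<close> separately, using
  \<open>f + g = 1\<close>.\<close>

lemma alpha_step: "\<alpha> (Suc j) - \<alpha> j = x * (\<alpha> (j + 2) - \<alpha> (Suc j)) + x * \<beta> (Suc j)"
proof -
  have "x * (\<alpha> (j + 2) - \<alpha> (Suc j)) + x * \<beta> (Suc j) =
      p * (1 + f * r) * (1 + r) ^ j * (x * (1 + r) * (r + 1 - g * r)) +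
      q * (1 + g * t) * (1 + t) ^ j * (x * (1 + t) * (t + 1 - f * t))"
    by (simp add: \<alpha>_def \<beta>_def algebra_simps)
  moreover have "r + 1 - g * r = 1 + f * r" "t + 1 - f * t = 1 + g * t"
    by (simp_all add: g_eq algebra_simps)
  ultimately have "x * (\<alpha> (j + 2) - \<alpha> (Suc j)) + x * \<beta> (Suc j) =
      p * (1 + f * r) * (1 + r) ^ j * r + q * (1 + g * t) * (1 + t) ^ j * t"
    using r t by simp
  then show ?thesis by (simp add: \<alpha>_def algebra_simps)
qed

lemma gamma_step: "\<gamma> (Suc j) - \<gamma> j = x * (\<alpha> (j + 2) - \<alpha> (Suc j)) + x * \<gamma> (Suc j)"
proof -
  have "x * (\<alpha> (j + 2) - \<alpha> (Suc j)) + x * \<gamma> (Suc j) =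
      p * (1 + f * r) * (1 + r) ^ j * (x * (1 + r) * (r - g)) +
      q * (1 + g * t) * (1 + t) ^ j * (x * (1 + t) * (t - f))"
    by (simp add: \<alpha>_def \<gamma>_def algebra_simps)
  \<comment> \<open>Here \<open>f * g = -1\<close> exposes the factor \<open>1 + f * r\<close>
    needed to apply the equation for \<open>r\<close>.\<close>
  also have "r - g = - g * (1 + f * r)"
    by (simp add: fg_mult algebra_simps)
  also have "t - f = - f * (1 + g * t)"
    by (simp add: fg_mult algebra_simps)
  finally have "x * (\<alpha> (j + 2) - \<alpha> (Suc j)) + x * \<gamma> (Suc j) =
      - g * p * (1 + f * r) * (1 + r) ^ j * (x * (1 + r) * (1 + f * r)) -
      f * q * (1 + g * t) * (1 + t) ^ j * (x * (1 + t) * (1 + g * t))"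
    by (simp add: mult_ac)
  then have "x * (\<alpha> (j + 2) - \<alpha> (Suc j)) + x * \<gamma> (Suc j) =
      - g * p * (1 + f * r) * (1 + r) ^ j * r - f * q * (1 + g * t) * (1 + t) ^ j * t"
    using r t by simp
  then show ?thesis by (simp add: \<gamma>_def algebra_simps)
qed

text \<open>The increment \<open>\<gamma> (Suc j) - \<gamma> j\<close> equals
  \<open>\<beta> j - \<alpha> j\<close>.\<close>

lemma beta_eq: "\<beta> j = \<alpha> j + x * (\<alpha> (j + 2) - \<alpha> (j + 1)) + x * \<gamma> (j + 1)"
proof -
  have "\<alpha> j + x * (\<alpha> (j + 2) - \<alpha> (j + 1)) + x * \<gamma> (j + 1) = \<alpha> j + (\<gamma> (Suc j) - \<gamma> j)"
    using gamma_step[of j] by (simp add: algebra_simps)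
  also have "\<dots> = \<beta> j"
    by (simp add: \<alpha>_def \<beta>_def \<gamma>_def algebra_simps)
  finally show ?thesis by simp
qed

text \<open>This is the recursion of \<open>descendants\<close> at the label
  \<open>(j + 1, j)\<close>: the last site gives \<open>\<alpha> (Suc j)\<close>, the
  \<open>i\<close>-th good one \<open>\<beta> i\<close>. Likewise \<open>gamma_rec\<close> and
  \<open>beta_rec\<close> belong to \<open>(j + 1, 0)\<close> and \<open>(j + 2, j)\<close>.\<close>

lemma alpha_rec: "\<alpha> j = 1 + x * \<alpha> (Suc j) + x * (\<Sum>i = 1..j. \<beta> i)"
proof (induction j)
  case (Suc j)
  then show ?case using alpha_step[of j] by (simp add: algebra_simps)
qed (use alpha_0 in simp)

lemma gamma_rec: "\<gamma> j = 1 + x * \<alpha> (Suc j) + x * (\<Sum>i = 1..j. \<gamma> i)"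
proof (induction j)
  case (Suc j)
  then show ?case using gamma_step[of j] by (simp add: algebra_simps)
qed (use gamma_0 in simp)

lemma beta_rec: "\<beta> j = 1 + x * \<alpha> (j + 2) + x * \<gamma> (Suc j) + x * (\<Sum>i = 1..j. \<beta> i)"
  using beta_eq[of j] alpha_rec[of j] by (simp add: algebra_simps)

end

text \<open>The three families of labels are closed under taking children, and apart from the
  constant 1 each recurrence carries a factor \<open>fps_X\<close>, so level \<open>m\<close>
  determines level \<open>Suc m\<close>.\<close>

lemma descendants_nth:
  fixes r t f g p q :: "real fps"
  assumes "kernel_roots fps_X r t f g p q"
  shows "real (descendants m (Suc j) j) = kernel_roots.\<alpha> r t f g p q j $ m"
    and "real (descendants m (j + 2) j) = kernel_roots.\<beta> r t f g p q j $ m"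
    and "real (descendants m (Suc j) 0) = kernel_roots.\<gamma> r t f g p q j $ m"
proof -
  interpret kernel_roots fps_X r t f g p q by fact
  have "(\<forall>j. real (descendants m (Suc j) j) = \<alpha> j $ m) \<and>
      (\<forall>j. real (descendants m (j + 2) j) = \<beta> j $ m) \<and>
      (\<forall>j. real (descendants m (Suc j) 0) = \<gamma> j $ m)"
  proof (induction m)
    case 0
    have "\<alpha> j $ 0 = 1" for j by (subst alpha_rec) simp
    moreover have "\<beta> j $ 0 = 1" for j by (subst beta_rec) simp
    moreover have "\<gamma> j $ 0 = 1" for j by (subst gamma_rec) simp
    ultimately show ?case by simp
  next
    case (Suc m)
    note IH = Suc[THEN conjunct1, rule_format] Suc[THEN conjunct2, THEN conjunct1, rule_format]
      Suc[THEN conjunct2, THEN conjunct2, rule_format]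
    have "\<alpha> j $ Suc m = \<alpha> (Suc j) $ m + (\<Sum>i = 1..j. \<beta> i $ m)" for j
      by (subst alpha_rec) (simp add: fps_sum_nth)
    moreover have "\<beta> j $ Suc m = \<alpha> (j + 2) $ m + \<gamma> (Suc j) $ m + (\<Sum>i = 1..j. \<beta> i $ m)" for j
      by (subst beta_rec) (simp add: fps_sum_nth)
    moreover have "\<gamma> j $ Suc m = \<alpha> (Suc j) $ m + (\<Sum>i = 1..j. \<gamma> i $ m)" for j
      by (subst gamma_rec) (simp add: fps_sum_nth)
    moreover have "{Suc j..<Suc j} = {}" "{Suc j..<j + 2} = {Suc j}" "{Suc 0..<Suc j} = {1..j}" for j
      by auto
    ultimately show ?case
      unfolding descendants.simps by (simp add: IH[symmetric])
  qed
  then show "real (descendants m (Suc j) j) = \<alpha> j $ m" "real (descendants m (j + 2) j) = \<beta> j $ m"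
    "real (descendants m (Suc j) 0) = \<gamma> j $ m" by blast+
qed

section \<open>The equations for r and t, and the closed form\<close>

text \<open>Assuming only \<open>s * s = 5\<close> serves both signs of the square root. The
  numerator has no constant term, so the quotient is a power series.\<close>

lemma root_expr_fps:
  fixes s :: real
  assumes s: "s * s = 5"
  defines "F \<equiv> fps_const ((1 + s) / 2)"
  obtains r where "root_expr s = fps_to_fls r" and "r = fps_X * (1 + r) * (1 + F * r)"
proof -
  let ?X = "fps_X :: real fps"
  define R where "R = 1 - fps_const (3 + s) * ?X + fps_const (1 / 2 * (3 - s)) * ?X ^ 2"
  define D where "D = fps_radical root 2 R"
  define N where "N = fps_const (s - 1) * (1 - D) - fps_const (1 + s) * ?X"
  define r where "r = fps_shift 1 N * fps_const (1 / 4)"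
  have R0: "R $ 0 = 1" by (simp add: R_def)
  have DD: "D * D = R"
    using power_radical[of R root 1] R0 by (simp add: D_def numeral_2_eq_2)
  have "N $ 0 = 0" using R0 by (simp add: N_def D_def)
  then have "N = fps_shift 1 N * ?X"
    by (intro fps_ext) (simp add: fps_X_mult_right_nth)
  then have N: "N = 4 * ?X * r"
    by (simp add: r_def mult_ac fps_numeral_fps_const)
  have FF: "F * F = F + 1"
    using s by (simp add: F_def field_simps flip: fps_const_1_eq_1)
  have S: "fps_const (s - 1) = 2 * F - 2" "fps_const (1 + s) = 2 * F"
    "fps_const (3 + s) = 2 * F + 2" "fps_const (1 / 2 * (3 - s)) = 2 - F"
    unfolding F_def fps_numeral_fps_const by (simp_all add: field_simps)
  have "root_expr s = fps_to_fls N / (4 * fls_X)"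
    unfolding root_expr_def N_def D_def R_def
    by (simp add: fls_times_fps_to_fls)
  also have "\<dots> = fps_to_fls r"
    unfolding N by (simp add: fls_times_fps_to_fls)
  finally have 1: "root_expr s = fps_to_fls r" .
  have "2 * ((F - 1) * (1 - D) - F * ?X - 2 * ?X * r) = 0"
    using N unfolding N_def S by (simp add: algebra_simps)
  then have "(F - 1) * (1 - D) - F * ?X - 2 * ?X * r = 0"
    unfolding mult_eq_0_iff by simp
  \<comment> \<open>Since \<open>F * (F - 1) = 1\<close>, this multiplication solves for
    \<open>D\<close>.\<close>
  then have "F * ((F - 1) * (1 - D) - F * ?X - 2 * ?X * r) = 0" by simp
  then have D: "D = 1 - (F + 1) * ?X - 2 * F * ?X * r"
    using FF by algebra
  \<comment> \<open>Comparing \<open>D * D\<close> with \<open>R\<close> gives the equation for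
    \<open>r\<close> times \<open>4 * F * ?X\<close>.\<close>
  have "4 * F * ?X * (?X * (1 + r) * (1 + F * r) - r) = 0"
    using DD FF unfolding D R_def S by algebra
  moreover have "F \<noteq> 0" using FF by auto
  ultimately have "r = ?X * (1 + r) * (1 + F * r)" by simp
  with 1 show ?thesis by (rule that)
qed

text \<open>Eliminating \<open>1 / x\<close> by the equation for \<open>r\<close> or for
  \<open>t\<close> makes \<open>e * t\<close> and \<open>e * r\<close> polynomials in
  \<open>r\<close> and \<open>t\<close>, where \<open>e\<close> is the denominator.\<close>

lemma quotient_identity:
  fixes r t x F G A :: "'a::field"
  assumes FG: "F + G = 1" "F * G = -1"
    and nz: "x \<noteq> 0" "r \<noteq> 0" "t \<noteq> 0" "F - G + r - t \<noteq> 0" "1 + r * t \<noteq> 0"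
    and r: "r = x * (1 + r) * (1 + F * r)" and t: "t = x * (1 + t) * (1 + G * t)"
    and A: "A * (F - G + r - t) = F * (F - t) * (1 + F * r) - G * (G - r) * (1 + G * t)"
  shows "A = 1 + (1 + r * t) / (1 + 1 / r + 1 / t - 1 / x)"
proof -
  define e where "e = 1 + 1 / r + 1 / t - 1 / x"
  have G: "G = 1 - F" using FG(1) by (simp add: eq_diff_eq add.commute)
  have FF: "F * F = F + 1" using FG(2) unfolding G by (simp add: algebra_simps)
  have "1 / x = (1 + r) * (1 + F * r) / r" using nz(1,2) r by (simp add: field_simps)
  then have "1 / x = 1 / r + F + 1 + F * r" using nz(2) by (simp add: field_simps)
  then have e1: "e * t = 1 - F * t - F * r * t" using nz(3) by (simp add: e_def field_simps)
  have "1 / x = (1 + t) * (1 + G * t) / t" using nz(1,3) t by (simp add: field_simps)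
  then have "1 / x = 1 / t + G + 1 + G * t" using nz(3) by (simp add: field_simps)
  then have e2: "e * r = 1 - G * r - G * r * t" using nz(2) by (simp add: e_def field_simps)
  have K: "(A - 1) * (F - G + r - t) = (F + 1) * r - (G + 1) * t - (F - G) * (r * t)"
    using A FF G by algebra
  have "(A - 1) * (F - G + r - t) * e =
      (F + 1) * (e * r) - (G + 1) * (e * t) - F * t * (e * r) + G * r * (e * t)"
    unfolding K by (simp add: algebra_simps)
  also have "\<dots> = (1 + r * t) * (F - G + r - t)"
    unfolding e1 e2 using FF G by algebra
  finally have "(A - 1) * (F - G + r - t) * e = (1 + r * t) * (F - G + r - t)" .
  then have eq: "(A - 1) * e = 1 + r * t" using nz(4) by (simp add: mult_ac)
  \<comment> \<open>The denominator is nonzero because its product with \<open>A - 1\<close> is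
    \<open>1 + r * t\<close>.\<close>
  then have "e \<noteq> 0" using nz(5) by auto
  then have "A - 1 = (1 + r * t) / e" using eq by (simp add: eq_divide_eq)
  then show ?thesis unfolding e_def by (simp add: algebra_simps)
qed

theorem theorem3p44:
  fixes r t :: "real fls"
  assumes "r = root_expr (sqrt 5)" and "t = root_expr (- sqrt 5)"
  shows "fps_to_fls (avoidance_gf {[3,4,1,2], [3,4,2,1], [2,3,4,1]}) =
           1 + (1 + r * t) / (1 + 1 / r + 1 / t - 1 / fls_X)"
proof -
  define F G :: "real fps" where "F = fps_const ((1 + sqrt 5) / 2)" and "G = fps_const ((1 - sqrt 5) / 2)"
  have FG: "F + G = 1" "F * G = -1"
    by (simp_all add: F_def G_def field_simps flip: fps_const_1_eq_1 fps_const_neg)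
  obtain r' where r': "r = fps_to_fls r'" "r' = fps_X * (1 + r') * (1 + F * r')"
    using root_expr_fps[of "sqrt 5"] assms(1) by (auto simp: F_def)
  obtain t' where t': "t = fps_to_fls t'" "t' = fps_X * (1 + t') * (1 + G * t')"
    using root_expr_fps[of "- sqrt 5"] assms(2) by (auto simp: G_def)
  \<comment> \<open>The determinant of \<open>pq1\<close>, \<open>pq2\<close> as a linear system in
    \<open>p\<close> and \<open>q\<close>; Cramer's rule gives the values below. Its constant term
    \<open>sqrt 5\<close> makes it invertible.\<close>
  define d where "d = F - G + r' - t'"
  have r0: "r' $ 0 = 0" and t0: "t' $ 0 = 0"
    by (subst r'(2), simp add: mult.assoc) (subst t'(2), simp add: mult.assoc)
  have "d $ 0 = sqrt 5" by (simp add: d_def r0 t0 F_def G_def field_simps)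
  then have d: "d * inverse d = 1" "d \<noteq> 0"
    by (auto simp: inverse_mult_eq_1')
  define p q where "p = F * (F - t') * inverse d" and "q = - G * (G - r') * inverse d"
  interpret kernel_roots fps_X r' t' F G p q
  proof
    show "(1 - G * r') * p + (1 - F * t') * q = 1" "G * p + F * q = -1"
      using d(1) FG unfolding p_def q_def d_def by algebra+
  qed (fact FG r'(2) t'(2))+
  have a0: "\<alpha> 0 = p * (1 + F * r') + q * (1 + G * t')"
    by (simp add: \<alpha>_def)
  \<comment> \<open>\<open>\<alpha> 0\<close> belongs to the label \<open>(1, 0)\<close> of the
    empty permutation.\<close>
  have "avoidance_gf {[3,4,1,2], [3,4,2,1], [2,3,4,1]} = \<alpha> 0"
    using descendants_nth(1)[OF kernel_roots_axioms, of _ 0]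
    unfolding avoidance_gf_def avoiding_perms_eq card_pattern_free_perms
    by (intro fps_ext) simp
  moreover have "\<alpha> 0 * d = F * (F - t') * (1 + F * r') - G * (G - r') * (1 + G * t')"
    using d(1) unfolding a0 unfolding p_def q_def by algebra
  ultimately have "fps_to_fls (avoidance_gf {[3,4,1,2], [3,4,2,1], [2,3,4,1]}) * fps_to_fls d =
      fps_to_fls (F * (F - t') * (1 + F * r') - G * (G - r') * (1 + G * t'))"
    by (simp only: flip: fls_times_fps_to_fls)
  note A = this[unfolded d_def]
  have 0: "r' \<noteq> 0" "t' \<noteq> 0" using r'(2) t'(2) by auto
  have "(1 + r' * t') $ 0 = 1" using r0 by simp
  then have 1: "1 + r' * t' \<noteq> 0" by (metis fps_zero_nth zero_neq_one)
  show ?thesis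
  proof (rule quotient_identity[where F = "fps_to_fls F" and G = "fps_to_fls G"])
    show "fps_to_fls F + fps_to_fls G = 1" "fps_to_fls F * fps_to_fls G = -1"
      using FG by (simp_all flip: fps_to_fls_plus fls_times_fps_to_fls)
    show "r \<noteq> 0" "t \<noteq> 0" using 0 r'(1) t'(1) by auto
    show "fps_to_fls F - fps_to_fls G + r - t \<noteq> 0" using d(2)
      unfolding r'(1) t'(1) d_def by (simp flip: fps_to_fls_plus fps_to_fls_minus)
    have "fps_to_fls (1 + r' * t') \<noteq> 0" using 1 by (simp del: fps_to_fls_plus)
    then show "1 + r * t \<noteq> 0" unfolding r'(1) t'(1) by (simp add: fls_times_fps_to_fls)
    show "r = fls_X * (1 + r) * (1 + fps_to_fls F * r)"
      using arg_cong[OF r'(2), of fps_to_fls] unfolding r'(1) by (simp add: fls_times_fps_to_fls)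
    show "t = fls_X * (1 + t) * (1 + fps_to_fls G * t)"
      using arg_cong[OF t'(2), of fps_to_fls] unfolding t'(1) by (simp add: fls_times_fps_to_fls)
  qed (use A in \<open>simp_all add: r'(1) t'(1) fls_times_fps_to_fls\<close>)
qed

end
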